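(* Let $V$ be a finite-dimensional Euclidean space and let $K\subset V$ be a regular cone. Let $L\subset V$ be a proper affine subspace with $\operatorname{codim}(L)\geq 2$ and let $\widehat{L}$ be the linear span of $L$ in $V$. The conic programs $K\cap L$ and $(-K)\cap L$ are both stably infeasible if and only if $K\cap \widehat{L} = \{0\}$.
   Context: A regular cone in $V$ is a closed convex cone (closed under multiplication by nonnegative scalars) that is pointed ($K\cap(-K)=\{0\}$) and has non-empty interior. An affine subspace $L\subset V$ is called proper if $0\notin L$. For a cone $C\subset V$ and a $d$-dimensional affine subspace $L\subset V$, the conic program $C\cap L$ is infeasible if $C\cap L=\emptyset$. It is stably infeasible if there exists an open neighborhood $N$ of $L$ in the Grassmannian of $d$-dimensional affine subspaces of $V$ such that $C\cap L'=\emptyset$ for all $L'\in N$. The Grassmannian of $d$-dimensional affine subspaces of $V$ carries its usual topology: identify an affine subspace $L$ with the $(d+1)$-dimensional linear subspace of $\mathbb{R}\oplus V$ spanned by $\{1\}\times L$; this realizes it as the open subset of the Grassmannian of $(d+1)$-dimensional linear subspaces of $\mathbb{R}\oplus V$ consisting of those not contained in $\{0\}\oplus V$. *)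

theory Defs
  imports "HOL-Analysis.Analysis"
begin

definition regular_cone :: "'a::euclidean_space set \<Rightarrow> bool" where
  "regular_cone K \<longleftrightarrow>
     closed K \<and> convex K \<and> cone K \<and> K \<inter> uminus ` K = {0} \<and> interior K \<noteq> {}"

section \<open>The topology on the Grassmannian of linear subspaces\<close>

definition subspaces_of_dim :: "nat \<Rightarrow> 'a::euclidean_space set set" where
  "subspaces_of_dim k = {S. subspace S \<and> dim S = k}"

text \<open>The space of \<open>k\<close>-frames (linearly independent \<open>k\<close>-tuples of vectors), as a subspace of
  the \<open>k\<close>-fold product of the ambient vector space.\<close>

definition frame_topology :: "nat \<Rightarrow> (nat \<Rightarrow> 'a::euclidean_space) topology" where
  "frame_topology k =
     subtopology (product_topology (\<lambda>_. euclidean) {..<k})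
       {v. inj_on v {..<k} \<and> independent (v ` {..<k})}"

text \<open>The Grassmannian carries the quotient topology with respect to the surjection sending a
  \<open>k\<close>-frame to its span.\<close>

definition grassmannian_topology :: "nat \<Rightarrow> 'a::euclidean_space set topology" where
  "grassmannian_topology k =
     topology (\<lambda>U. U \<subseteq> subspaces_of_dim k \<and>
       openin (frame_topology k) {v \<in> topspace (frame_topology k). span (v ` {..<k}) \<in> U})"

lemma topspace_frame_topology:
  "topspace (frame_topology k) =
     {v \<in> extensional {..<k}. inj_on v {..<k} \<and> independent (v ` {..<k})}"
  by (auto simp: frame_topology_def PiE_def)

lemma openin_grassmannian_topology:
  "openin (grassmannian_topology k) U \<longleftrightarrow>
     U \<subseteq> subspaces_of_dim k \<and>
     openin (frame_topology k) {v \<in> topspace (frame_topology k). span (v ` {..<k}) \<in> U}"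
proof -
  let ?T = "topspace (frame_topology k) :: (nat \<Rightarrow> 'a) set"
  have int: "{v \<in> ?T. span (v ` {..<k}) \<in> S \<inter> T} =
      {v \<in> ?T. span (v ` {..<k}) \<in> S} \<inter> {v \<in> ?T. span (v ` {..<k}) \<in> T}" for S T
    by auto
  have un: "{v \<in> ?T. span (v ` {..<k}) \<in> \<Union>\<U>} = (\<Union>S\<in>\<U>. {v \<in> ?T. span (v ` {..<k}) \<in> S})" for \<U>
    by auto
  have "istopology (\<lambda>U. U \<subseteq> subspaces_of_dim k \<and>
       openin (frame_topology k) {v \<in> ?T. span (v ` {..<k}) \<in> U})"
    unfolding istopology_def int un by (blast intro: openin_Int openin_Union)
  then show ?thesis
    by (simp add: grassmannian_topology_def topology_inverse')
qed

lemma span_frame: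
  assumes "v \<in> topspace (frame_topology k)"
  shows "span (v ` {..<k}) \<in> subspaces_of_dim k"
  using assms by (auto simp: topspace_frame_topology subspaces_of_dim_def dim_eq_card_independent card_image)

lemma topspace_grassmannian_topology: "topspace (grassmannian_topology k) = (subspaces_of_dim k :: 'a::euclidean_space set set)"
proof -
  have "{v \<in> topspace (frame_topology k). span (v ` {..<k}) \<in> subspaces_of_dim k} =
      (topspace (frame_topology k) :: (nat \<Rightarrow> 'a) set)"
    using span_frame by blast
  then have "openin (grassmannian_topology k) (subspaces_of_dim k :: 'a set set)"
    by (simp add: openin_grassmannian_topology)
  then have "subspaces_of_dim k \<subseteq> topspace (grassmannian_topology k :: 'a set topology)"
    by (rule openin_subset)
  moreover have "topspace (grassmannian_topology k :: 'a set topology) \<subseteq> subspaces_of_dim k"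
    using openin_topspace [of "grassmannian_topology k :: 'a set topology"]
    unfolding openin_grassmannian_topology by (rule conjunct1)
  ultimately show ?thesis
    by (rule subset_antisym [rotated])
qed

lemma quotient_map_span:
  "quotient_map (frame_topology k) (grassmannian_topology k)
     (\<lambda>v. span (v ` {..<k}) :: 'a::euclidean_space set)"
proof -
  have "S \<in> (\<lambda>v. span (v ` {..<k})) ` topspace (frame_topology k)"
    if S: "S \<in> subspaces_of_dim k" for S :: "'a set"
  proof -
    obtain B where B: "B \<subseteq> S" "independent B" "S \<subseteq> span B" "card B = k"
    proof (rule basis_exists [of S])
      fix B assume "B \<subseteq> S" "independent B" "S \<subseteq> span B" "card B = dim S"
      then show thesis
        using that S by (simp add: subspaces_of_dim_def)
    qed
    then have "finite B" by (simp add: independent_imp_finite)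
    then obtain h where h: "bij_betw h {..<k} B"
      using ex_bij_betw_nat_finite [of B] B(4) by (auto simp: atLeast0LessThan)
    have im: "restrict h {..<k} ` {..<k} = B"
      using h by (simp add: bij_betw_def)
    have "inj_on (restrict h {..<k}) {..<k}"
      using h by (simp add: bij_betw_def inj_on_restrict_eq)
    then have "restrict h {..<k} \<in> topspace (frame_topology k)"
      using B im by (simp add: topspace_frame_topology)
    moreover have "span B = S"
      using B S by (intro subset_antisym span_minimal) (auto simp: subspaces_of_dim_def)
    ultimately show ?thesis
      using im by (intro image_eqI [of _ _ "restrict h {..<k}"]) simp_all
  qed
  then have "(\<lambda>v. span (v ` {..<k})) ` topspace (frame_topology k) =
      (subspaces_of_dim k :: 'a set set)"
    using span_frame by blast
  then show ?thesis
    unfolding quotient_map_def topspace_grassmannian_topology openin_grassmannian_topology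
    by simp
qed

section \<open>The Grassmannian of affine subspaces\<close>

definition affine_subspaces_of_dim :: "nat \<Rightarrow> 'a::euclidean_space set set" where
  "affine_subspaces_of_dim d = {L. affine L \<and> aff_dim L = int d}"

definition homogenization :: "'a::euclidean_space set \<Rightarrow> (real \<times> 'a) set" where
  "homogenization L = span ({1} \<times> L)"

definition affine_grassmannian_topology :: "nat \<Rightarrow> 'a::euclidean_space set topology" where
  "affine_grassmannian_topology d =
     pullback_topology (affine_subspaces_of_dim d) homogenization (grassmannian_topology (Suc d))"

lemma homogenization_in_subspaces_of_dim:
  assumes "L \<in> affine_subspaces_of_dim d"
  shows "homogenization L \<in> subspaces_of_dim (Suc d)"
proof -
  let ?S = "{1::real} \<times> L"
  have "?S = (+) (1, 0) ` (Pair 0 ` L)"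
    by (auto simp: image_image)
  then have "aff_dim ?S = aff_dim (Pair (0::real) ` L)"
    by (simp only: aff_dim_translation_eq)
  also have "\<dots> = aff_dim L"
    by (rule aff_dim_injective_linear_image) (auto simp: inj_on_def intro!: linearI)
  finally have ad: "aff_dim ?S = int d"
    using assms by (simp add: affine_subspaces_of_dim_def)
  have "affine ?S"
    using assms by (auto simp: affine_subspaces_of_dim_def affine_def)
  then have hull: "affine hull ?S = ?S"
    by (simp add: affine_hull_eq)
  have "0 \<notin> affine hull ?S"
    unfolding hull by (auto simp: zero_prod_def)
  then have "aff_dim (insert 0 ?S) = int d + 1"
    by (simp add: aff_dim_insert ad)
  moreover have "aff_dim (insert 0 ?S) = int (dim (insert 0 ?S))"
    by (rule aff_dim_zero) (simp add: hull_inc)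
  ultimately have "dim ?S = Suc d"
    by (simp add: dim_insert span_zero)
  then show ?thesis
    by (simp add: homogenization_def subspaces_of_dim_def)
qed

lemma homogenization_slice:
  assumes "affine L"
  shows "{x. (1, x) \<in> homogenization L} = L"
proof (cases "L = {}")
  case True
  then show ?thesis by (auto simp: homogenization_def zero_prod_def)
next
  case False
  then obtain a where a: "a \<in> L" by blast
  let ?D = "(\<lambda>x. x - a) ` L"
  have D: "subspace ?D"
    using affine_diffs_subspace_subtract [OF assms a] by simp
  let ?H = "{p :: real \<times> 'a. snd p - fst p *\<^sub>R a \<in> ?D}"
  have "?H = (\<lambda>p. snd p - fst p *\<^sub>R a) -` ?D" by auto
  moreover have "linear (\<lambda>p :: real \<times> 'a. snd p - fst p *\<^sub>R a)"
    by (auto intro!: linearI simp: algebra_simps)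
  ultimately have "subspace ?H"
    using D by (simp add: linear_subspace_vimage)
  then have "homogenization L \<subseteq> ?H"
    unfolding homogenization_def by (intro span_minimal) auto
  then show ?thesis
    by (auto simp: homogenization_def intro: span_base)
qed

lemma inj_on_homogenization: "inj_on homogenization (affine_subspaces_of_dim d)"
  by (rule inj_on_inverseI [where g = "\<lambda>S. {x. (1, x) \<in> S}"])
    (simp add: affine_subspaces_of_dim_def homogenization_slice)

lemma topspace_affine_grassmannian_topology:
  "topspace (affine_grassmannian_topology d) = affine_subspaces_of_dim d"
  using homogenization_in_subspaces_of_dim
  by (auto simp: affine_grassmannian_topology_def topspace_pullback_topology
      topspace_grassmannian_topology)

section \<open>Stable infeasibility\<close>

text \<open>For nonempty affine \<open>L\<close>, \<^term>\<open>nat (aff_dim L)\<close> is its dimension.\<close>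

definition stably_infeasible :: "'a::euclidean_space set \<Rightarrow> 'a set \<Rightarrow> bool" where
  "stably_infeasible C L \<longleftrightarrow>
     (\<exists>N. openin (affine_grassmannian_topology (nat (aff_dim L))) N \<and> L \<in> N \<and>
          (\<forall>L'\<in>N. C \<inter> L' = {}))"

end

theory Submission
  imports Defs
begin

text \<open>
  Since \<open>0 \<notin> L\<close>, there is a vector \<open>p\<close> with \<open>L = {x \<in> span L. p \<bullet> x = 1}\<close>, and the
  homogenization of \<open>L\<close> is the graph of \<open>x \<mapsto> p \<bullet> x\<close> over \<open>span L\<close>.

  If \<open>K\<close> meets \<open>span L\<close> only in \<open>0\<close>, then this graph meets the closed cone \<open>\<real> \<times> K\<close> only in
  \<open>0\<close>, and trivial intersection with a closed cone is an open condition on subspaces, by compactness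
  of the sphere of coefficient vectors.

  Conversely, let \<open>0 \<noteq> k \<in> K \<inter> span L\<close>. Replacing \<open>(K, k)\<close> by \<open>(-K, -k)\<close> if necessary,
  \<open>p \<bullet> k \<ge> 0\<close>. Then \<open>(p + \<epsilon> k) \<bullet> k > 0\<close> for \<open>\<epsilon> > 0\<close>, so a positive multiple of \<open>k\<close> lies in
  \<open>{x \<in> span L. (p + \<epsilon> k) \<bullet> x = 1}\<close>, and these affine subspaces converge to \<open>L\<close>.
\<close>

section \<open>Linear combinations of frames\<close>

lemma span_image_finite_sum:
  fixes v :: "'i \<Rightarrow> 'a::real_vector"
  assumes "finite I" "inj_on v I" "x \<in> span (v ` I)"
  obtains c where "x = (\<Sum>i\<in>I. c i *\<^sub>R v i)"
proof -
  obtain u where "x = (\<Sum>w\<in>v ` I. u w *\<^sub>R w)"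
    using assms by (auto simp: span_finite)
  then have "x = (\<Sum>i\<in>I. u (v i) *\<^sub>R v i)"
    by (simp add: sum.reindex assms(2))
  then show thesis by (rule that)
qed

lemma independent_image_sum_eq_0:
  fixes v :: "'i \<Rightarrow> 'a::real_vector"
  assumes "finite I" "inj_on v I" "independent (v ` I)"
    and "(\<Sum>i\<in>I. c i *\<^sub>R v i) = 0" "i \<in> I"
  shows "c i = 0"
proof -
  \<comment> \<open>Injectivity of \<open>v\<close> moves the coefficients from indices to vectors,
    where \<open>independentD\<close> applies.\<close>
  have "(\<Sum>w\<in>v ` I. c (the_inv_into I v w) *\<^sub>R w) = (\<Sum>i\<in>I. c i *\<^sub>R v i)"
    by (simp add: sum.reindex assms(2) the_inv_into_f_f cong: sum.cong)
  then have "c (the_inv_into I v (v i)) = 0"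
    using assms by (intro independentD [OF assms(3), of "v ` I"]) auto
  then show ?thesis
    by (simp add: the_inv_into_f_f assms)
qed

section \<open>Openness of trivial intersection with a closed cone\<close>

lemma continuous_map_scaleR:
  fixes g :: "'b \<Rightarrow> 'a::real_normed_vector"
  assumes "continuous_map X euclideanreal f" "continuous_map X euclidean g"
  shows "continuous_map X euclidean (\<lambda>x. f x *\<^sub>R g x)"
  using assms by (simp add: continuous_map_atin limitin_canonical_iff tendsto_scaleR)

text \<open>The unit sphere of \<real>^k; extensionality places it in the carrier of the product
  topology over \<open>{..<k}\<close>.\<close>

definition coeff_sphere :: "nat \<Rightarrow> (nat \<Rightarrow> real) set" where
  "coeff_sphere k = {c \<in> extensional {..<k}. (\<Sum>i<k. (c i)\<^sup>2) = 1}"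

lemma compactin_coeff_sphere:
  "compactin (product_topology (\<lambda>_. euclideanreal) {..<k}) (coeff_sphere k)"
proof (rule closed_compactin)
  let ?X = "product_topology (\<lambda>_. euclideanreal) {..<k}"
  show "compactin ?X (PiE {..<k} (\<lambda>_. {-1..1}))"
    by (simp add: compactin_PiE)
  show "coeff_sphere k \<subseteq> PiE {..<k} (\<lambda>_. {-1..1})"
  proof
    fix c assume c: "c \<in> coeff_sphere k"
    have "\<bar>c i\<bar> \<le> 1" if "i < k" for i
    proof -
      have "(c i)\<^sup>2 \<le> (\<Sum>i<k. (c i)\<^sup>2)"
        using that by (intro member_le_sum) auto
      then show ?thesis
        using c by (simp add: coeff_sphere_def abs_square_le_1)
    qed
    then show "c \<in> PiE {..<k} (\<lambda>_. {-1..1})"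
      using c by (auto simp: PiE_iff coeff_sphere_def abs_le_iff minus_le_iff)
  qed
  have "continuous_map ?X euclideanreal (\<lambda>c. \<Sum>i<k. (c i)\<^sup>2)"
    by (intro continuous_map_sum continuous_map_real_pow continuous_map_product_projection) auto
  then have "closedin ?X {c \<in> topspace ?X. (\<Sum>i<k. (c i)\<^sup>2) \<in> {1}}"
    by (rule closedin_continuous_map_preimage) simp
  then show "closedin ?X (coeff_sphere k)"
    by (simp add: coeff_sphere_def PiE_def)
qed

text \<open>By the quotient topology it suffices to show that the bad frames form a closed set. They
  are the projection of the closed set of pairs (frame, unit coefficient vector) whose combination
  lies in \<open>C\<close>, and projecting along a compact factor is a closed map.\<close>

lemma openin_grassmannian_Int_cone:
  fixes C :: "'a::euclidean_space set"
  assumes "closed C" "cone C"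
  shows "openin (grassmannian_topology k) {S \<in> subspaces_of_dim k. S \<inter> C \<subseteq> {0}}"
proof -
  let ?F = "frame_topology k :: (nat \<Rightarrow> 'a) topology"
  let ?X = "product_topology (\<lambda>_. euclideanreal) {..<k}"
  let ?Y = "subtopology ?X (coeff_sphere k)"
  let ?lin = "\<lambda>(v :: nat \<Rightarrow> 'a, c). \<Sum>i<k. c i *\<^sub>R v i"
  let ?Z = "{z \<in> topspace (prod_topology ?F ?Y). ?lin z \<in> C}"
  have proj1: "continuous_map (prod_topology ?F ?Y) euclidean (\<lambda>z. fst z i)" if "i < k" for i
  proof -
    have "continuous_map ?F euclidean (\<lambda>v. v i)"
      unfolding frame_topology_def using that
      by (intro continuous_map_from_subtopology continuous_map_product_projection) simp
    from continuous_map_compose [OF continuous_map_fst this] show ?thesis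
      by (simp add: o_def)
  qed
  have proj2: "continuous_map (prod_topology ?F ?Y) euclideanreal (\<lambda>z. snd z i)" if "i < k" for i
  proof -
    have "continuous_map ?Y euclidean (\<lambda>c. c i)"
      using that by (intro continuous_map_from_subtopology continuous_map_product_projection) simp
    from continuous_map_compose [OF continuous_map_snd this] show ?thesis
      by (simp add: o_def)
  qed
  have "continuous_map (prod_topology ?F ?Y) euclidean ?lin"
    unfolding case_prod_beta
    by (intro continuous_map_sum continuous_map_scaleR proj1 proj2) auto
  then have "closedin (prod_topology ?F ?Y) ?Z"
    by (rule closedin_continuous_map_preimage) (simp add: assms(1))
  moreover have "compact_space ?Y"
    by (simp add: compactin_coeff_sphere compact_space_subtopology)
  ultimately have closed: "closedin ?F (fst ` ?Z)"
    using closed_map_fst unfolding closed_map_def by blast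
  have "{v \<in> topspace ?F. span (v ` {..<k}) \<in> {S \<in> subspaces_of_dim k. S \<inter> C \<subseteq> {0}}} =
      topspace ?F - fst ` ?Z" (is "?U = _")
  proof (intro set_eqI iffI)
    fix v assume v: "v \<in> ?U"
    have "False" if c: "c \<in> coeff_sphere k" "(\<Sum>i<k. c i *\<^sub>R v i) \<in> C" for c
    proof -
      have "(\<Sum>i<k. c i *\<^sub>R v i) \<in> span (v ` {..<k})"
        by (intro span_sum span_scale span_base) auto
      then have "(\<Sum>i<k. c i *\<^sub>R v i) = 0"
        using v c by blast
      then have "c i = 0" if "i < k" for i
        using v that
        by (intro independent_image_sum_eq_0 [of "{..<k}" v]) (auto simp: topspace_frame_topology)
      then show False
        using c(1) by (simp add: coeff_sphere_def)
    qed
    then show "v \<in> topspace ?F - fst ` ?Z"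
      using v by auto
  next
    fix v assume v: "v \<in> topspace ?F - fst ` ?Z"
    have "x = 0" if x: "x \<in> span (v ` {..<k})" "x \<in> C" for x
    proof (rule ccontr)
      assume "x \<noteq> 0"
      obtain c where c: "x = (\<Sum>i<k. c i *\<^sub>R v i)"
        using span_image_finite_sum [of "{..<k}" v x] v x by (auto simp: topspace_frame_topology)
      \<comment> \<open>A nonzero \<open>x\<close> has a nonzero coefficient vector. Dividing it by
        its norm \<open>sqrt s\<close> lands on the sphere, and the cone \<open>C\<close> absorbs
        the factor.\<close>
      define s where "s = (\<Sum>i<k. (c i)\<^sup>2)"
      have "s \<noteq> 0"
      proof
        assume "s = 0"
        then have "\<forall>i<k. c i = 0"
          by (simp add: s_def sum_nonneg_eq_0_iff)
        then show False
          using \<open>x \<noteq> 0\<close> c by simp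
      qed
      moreover have "s \<ge> 0" by (simp add: s_def sum_nonneg)
      ultimately have s: "s > 0" by simp
      define d where "d = restrict (\<lambda>i. c i / sqrt s) {..<k}"
      have "(\<Sum>i<k. (d i)\<^sup>2) = (\<Sum>i<k. (c i)\<^sup>2 / s)"
        using s by (intro sum.cong) (auto simp: d_def power_divide)
      also have "\<dots> = 1"
        using s by (simp add: s_def flip: sum_divide_distrib)
      finally have d: "d \<in> coeff_sphere k"
        by (simp add: coeff_sphere_def d_def)
      have "(\<Sum>i<k. d i *\<^sub>R v i) = (1 / sqrt s) *\<^sub>R x"
        by (simp add: d_def c scaleR_sum_right)
      moreover have "(1 / sqrt s) *\<^sub>R x \<in> C"
        using assms(2) x(2) s by (intro mem_cone) auto
      ultimately have "(v, d) \<in> ?Z"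
        using d v by (simp add: coeff_sphere_def PiE_def)
      then show False
        using v by force
    qed
    then show "v \<in> ?U"
      using v span_frame by auto
  qed
  then show ?thesis
    unfolding openin_grassmannian_topology
    using closed by (auto intro: openin_diff)
qed

section \<open>Affine subspaces as hyperplane sections, and their homogenizations\<close>

lemma openin_affine_grassmannian_topology:
  "openin (affine_grassmannian_topology d) N \<longleftrightarrow>
    (\<exists>U. openin (grassmannian_topology (Suc d)) U \<and>
      N = homogenization -` U \<inter> affine_subspaces_of_dim d)"
  by (simp add: affine_grassmannian_topology_def openin_pullback_topology)

text \<open>The point \<open>c\<close> of \<open>L\<close> closest to the origin is orthogonal to
  the directions of \<open>L\<close>, so \<open>p = c /\<^sub>R (c \<bullet> c)\<close> is
  constantly 1 on \<open>L\<close>.\<close>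

lemma affine_eq_span_Int_hyperplane:
  fixes L :: "'a::euclidean_space set"
  assumes "affine L" "L \<noteq> {}" "0 \<notin> L"
  obtains p where "L = span L \<inter> {x. p \<bullet> x = 1}"
proof -
  define c where "c = closest_point L 0"
  have cL: "c \<in> L"
    using assms by (simp add: c_def closest_point_in_set affine_closed)
  then have c0: "c \<noteq> 0" using assms by blast
  have le: "c \<bullet> c \<le> c \<bullet> x" if "x \<in> L" for x
    using closest_point_dot [of L x 0] that assms
    by (simp add: c_def [symmetric] affine_imp_convex affine_closed inner_diff_right)
  have eq: "c \<bullet> x = c \<bullet> c" if "x \<in> L" for x
  proof -
    \<comment> \<open>Reflecting \<open>x\<close> through \<open>c\<close> stays in \<open>L\<close>
      and turns \<open>le\<close> into the reverse inequality.\<close>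
    have "2 *\<^sub>R c + (-1) *\<^sub>R x \<in> L"
      using assms(1) cL that by (intro mem_affine) auto
    from le [OF this] le [OF that] show ?thesis
      by (simp add: inner_diff_right inner_add_right)
  qed
  define p where "p = c /\<^sub>R (c \<bullet> c)"
  have p: "p \<bullet> x = 1" if "x \<in> L" for x
    using eq [OF that] c0 by (simp add: p_def)
  \<comment> \<open>The left side is linear in \<open>x\<close> and \<open>L - c\<close> is a
    subspace, so checking \<open>x \<in> L\<close> suffices. At \<open>p \<bullet> x = 1\<close> the
    claim says \<open>x \<in> L\<close>.\<close>
  have sub: "x - (p \<bullet> x) *\<^sub>R c \<in> (\<lambda>x. x - c) ` L" if "x \<in> span L" for x
    using that
  proof (induction rule: span_induct)
    case base
    have "linear (\<lambda>x. x - (p \<bullet> x) *\<^sub>R c)"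
      by (auto intro!: linearI simp: algebra_simps inner_add_right)
    moreover have "subspace ((\<lambda>x. x - c) ` L)"
      using affine_diffs_subspace_subtract [OF assms(1) cL] by simp
    ultimately have "subspace ((\<lambda>x. x - (p \<bullet> x) *\<^sub>R c) -` ((\<lambda>x. x - c) ` L))"
      by (rule linear_subspace_vimage)
    then show ?case by (simp add: vimage_def)
  next
    case (step x)
    then show ?case by (simp add: p)
  qed
  have "L = span L \<inter> {x. p \<bullet> x = 1}"
  proof
    show "L \<subseteq> span L \<inter> {x. p \<bullet> x = 1}"
      using p by (auto intro: span_base)
    show "span L \<inter> {x. p \<bullet> x = 1} \<subseteq> L"
      using sub by fastforce
  qed
  then show thesis by (rule that)
qed

lemma aff_dim_subspace_Int_hyperplane:
  fixes M :: "'a::euclidean_space set"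
  assumes "subspace M" "M \<inter> {x. p \<bullet> x = 1} \<noteq> {}"
  shows "aff_dim (M \<inter> {x. p \<bullet> x = 1}) = int (dim M) - 1"
proof -
  \<comment> \<open>The origin lies in \<open>M\<close> but off the hyperplane, so the nonempty
    section loses exactly one dimension.\<close>
  have "\<not> M \<subseteq> {x. p \<bullet> x = 1}"
    using subspace_0 [OF assms(1)] by auto
  then show ?thesis
    using assms by (simp add: aff_dim_affine_Int_hyperplane subspace_imp_affine aff_dim_subspace)
qed

text \<open>The graph is a linear subspace containing \<open>{1} \<times> L\<close> for the section
  \<open>L\<close>, hence its span; both have dimension \<open>dim M\<close>, so they
  coincide.\<close>

lemma homogenization_subspace_Int_hyperplane:
  fixes M :: "'a::euclidean_space set"
  assumes "subspace M" "M \<inter> {x. p \<bullet> x = 1} \<noteq> {}"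
  shows "homogenization (M \<inter> {x. p \<bullet> x = 1}) = (\<lambda>x. (p \<bullet> x, x)) ` M" (is "homogenization ?L = ?g ` M")
proof -
  have lin: "linear ?g"
    by (auto intro!: linearI simp: inner_add_right)
  have dim_L: "aff_dim ?L = int (dim M) - 1"
    by (rule aff_dim_subspace_Int_hyperplane [OF assms])
  \<comment> \<open>Gives \<open>dim M \<ge> 1\<close>, so the natural subtraction
    \<open>dim M - 1\<close> does not truncate.\<close>
  moreover have "aff_dim ?L \<ge> 0"
    using assms(2) by (metis aff_dim_negative_iff linorder_not_less)
  ultimately have "?L \<in> affine_subspaces_of_dim (dim M - 1)" and "Suc (dim M - 1) = dim M"
    using assms by (auto simp: affine_subspaces_of_dim_def subspace_imp_affine affine_Int affine_hyperplane)
  then have H: "homogenization ?L \<in> subspaces_of_dim (dim M)"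
    using homogenization_in_subspaces_of_dim by metis
  have "dim (?g ` M) = dim M"
    by (rule dim_image_eq [OF lin]) (auto simp: inj_on_def)
  moreover have "homogenization ?L \<subseteq> ?g ` M"
    unfolding homogenization_def
    using assms(1) lin by (intro span_minimal linear_subspace_image) auto
  ultimately show ?thesis
    using H assms(1) lin
    by (intro subspace_dim_equal linear_subspace_image) (auto simp: subspaces_of_dim_def)
qed

section \<open>Trivial intersection with the span yields stability\<close>

lemma stably_infeasible_if_span_Int_trivial:
  fixes K L :: "'a::euclidean_space set"
  assumes K: "closed K" "cone K" and L: "affine L" "L \<noteq> {}" "0 \<notin> L"
    and trivial: "K \<inter> span L \<subseteq> {0}"
  shows "stably_infeasible K L"
proof -
  obtain p where p: "L = span L \<inter> {x. p \<bullet> x = 1}"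
    using affine_eq_span_Int_hyperplane [OF L] .
  define d where "d = nat (aff_dim L)"
  \<comment> \<open>If \<open>x\<close> lies in \<open>K\<close> and \<open>L'\<close>, then
    \<open>(1, x)\<close> is a nonzero point of \<open>homogenization L'\<close> in this cone, so
    \<open>U\<close> excludes all feasible \<open>L'\<close>.\<close>
  define C :: "(real \<times> 'a) set" where "C = UNIV \<times> K"
  define U where "U = {S \<in> subspaces_of_dim (Suc d). S \<inter> C \<subseteq> {0}}"
  have "closed C" "cone C"
    using K by (auto simp: C_def closed_Times cone_def)
  then have "openin (grassmannian_topology (Suc d)) U"
    unfolding U_def by (rule openin_grassmannian_Int_cone)
  then have "openin (affine_grassmannian_topology d) (homogenization -` U \<inter> affine_subspaces_of_dim d)"
    unfolding openin_affine_grassmannian_topology by blast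
  moreover have "L \<in> homogenization -` U \<inter> affine_subspaces_of_dim d"
  proof -
    have "aff_dim L \<ge> 0"
      using L(2) by (metis aff_dim_negative_iff linorder_not_less)
    then have Ld: "L \<in> affine_subspaces_of_dim d"
      using L(1) by (simp add: affine_subspaces_of_dim_def d_def)
    have "homogenization L = (\<lambda>x. (p \<bullet> x, x)) ` span L"
      using homogenization_subspace_Int_hyperplane [of "span L" p] p L(2) by simp
    then have "homogenization L \<inter> C \<subseteq> {0}"
      using trivial by (auto simp: C_def zero_prod_def)
    then show ?thesis
      using Ld homogenization_in_subspaces_of_dim [OF Ld] by (simp add: U_def)
  qed
  moreover have "K \<inter> L' = {}" if "L' \<in> homogenization -` U \<inter> affine_subspaces_of_dim d" for L'
  proof (rule ccontr)
    assume "K \<inter> L' \<noteq> {}"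
    then obtain x where x: "x \<in> K" "x \<in> L'" by blast
    then have "(1, x) \<in> homogenization L' \<inter> C"
      by (auto simp: homogenization_def C_def intro: span_base)
    then show False
      using that by (auto simp: U_def zero_prod_def)
  qed
  ultimately show ?thesis
    unfolding stably_infeasible_def d_def [symmetric] by blast
qed

section \<open>Perturbing the hyperplane within a fixed span\<close>

lemma continuous_map_frame_graph:
  fixes b :: "nat \<Rightarrow> 'a::euclidean_space"
  assumes "inj_on b {..<k}" "independent (b ` {..<k})"
  shows "continuous_map euclidean (frame_topology k) (\<lambda>p. \<lambda>i\<in>{..<k}. (p \<bullet> b i, b i))"
proof -
  have "inj_on (\<lambda>i. (p \<bullet> b i, b i)) {..<k} \<and> independent ((\<lambda>i. (p \<bullet> b i, b i)) ` {..<k})" for p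
  proof
    show "inj_on (\<lambda>i. (p \<bullet> b i, b i)) {..<k}"
      using assms(1) by (auto simp: inj_on_def)
    \<comment> \<open>The second coordinate makes the graph map injective for every
      \<open>p\<close>, so it sends frames to frames.\<close>
    have "linear (\<lambda>x. (p \<bullet> x, x))"
      by (auto intro!: linearI simp: inner_add_right)
    then have "independent ((\<lambda>x. (p \<bullet> x, x)) ` b ` {..<k})"
      by (intro linear_independent_injective_image assms(2)) (auto simp: inj_on_def)
    then show "independent ((\<lambda>i. (p \<bullet> b i, b i)) ` {..<k})"
      by (simp add: image_image)
  qed
  moreover have "continuous_map euclidean euclidean (\<lambda>p. (p \<bullet> b i, b i))" for i
    by (auto intro!: continuous_intros)
  ultimately show ?thesis
    unfolding frame_topology_def continuous_map_in_subtopology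
    by (auto simp: continuous_map_componentwise inj_on_restrict_eq)
qed

text \<open>A fixed basis of \<open>M\<close> lifts to a frame of the graph of each
  \<open>q\<close>, continuously in \<open>q\<close>; pulling back the open set behind
  \<open>N\<close> gives an open set of \<open>q\<close> around \<open>p\<close>. Nonemptiness lets
  the section of \<open>q\<close> be identified with its graph.\<close>

lemma eventually_affine_grassmannian_nbhd:
  fixes M :: "'a::euclidean_space set"
  assumes M: "subspace M" "dim M = Suc d"
    and ne: "M \<inter> {x. p \<bullet> x = 1} \<noteq> {}"
    and N: "openin (affine_grassmannian_topology d) N" "M \<inter> {x. p \<bullet> x = 1} \<in> N"
  shows "\<forall>\<^sub>F q in nhds p. M \<inter> {x. q \<bullet> x = 1} \<noteq> {} \<longrightarrow> M \<inter> {x. q \<bullet> x = 1} \<in> N"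
proof -
  obtain U where U: "openin (grassmannian_topology (Suc d)) U"
    "N = homogenization -` U \<inter> affine_subspaces_of_dim d"
    using N(1) by (auto simp: openin_affine_grassmannian_topology)
  obtain B where B: "B \<subseteq> M" "independent B" "M \<subseteq> span B" "card B = Suc d"
    using basis_exists [of M] M(2) by metis
  then have "finite B" by (simp add: independent_imp_finite)
  then obtain b where b: "bij_betw b {..<Suc d} B"
    using ex_bij_betw_nat_finite [of B] B(4) by (auto simp: atLeast0LessThan)
  then have b': "inj_on b {..<Suc d}" "b ` {..<Suc d} = B"
    by (auto simp: bij_betw_def)
  have span_B: "span B = M"
    using B M by (intro subset_antisym span_minimal) auto
  define \<phi> where "\<phi> = (\<lambda>q. \<lambda>i\<in>{..<Suc d}. (q \<bullet> b i, b i))"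
  have \<phi>: "continuous_map euclidean (frame_topology (Suc d)) \<phi>"
    unfolding \<phi>_def using b' B by (intro continuous_map_frame_graph) auto
  have span_\<phi>: "span (\<phi> q ` {..<Suc d}) = (\<lambda>x. (q \<bullet> x, x)) ` M" for q
  proof -
    have "linear (\<lambda>x. (q \<bullet> x, x))"
      by (auto intro!: linearI simp: inner_add_right)
    moreover have "\<phi> q ` {..<Suc d} = (\<lambda>x. (q \<bullet> x, x)) ` B"
      unfolding b'(2) [symmetric] by (simp add: \<phi>_def image_image)
    ultimately show ?thesis
      by (simp add: linear_span_image span_B)
  qed
  let ?W = "{v \<in> topspace (frame_topology (Suc d)). span (v ` {..<Suc d}) \<in> U}"
  have "openin (frame_topology (Suc d)) ?W"
    using U(1) by (simp add: openin_grassmannian_topology)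
  then have "open {q. \<phi> q \<in> ?W}"
    using openin_continuous_map_preimage [OF \<phi>] unfolding open_openin [symmetric] topspace_euclidean
    by (metis (no_types, lifting) Collect_cong UNIV_I)
  moreover have "\<phi> q \<in> topspace (frame_topology (Suc d))" for q
    using continuous_map_image_subset_topspace [OF \<phi>] by auto
  ultimately have "open {q. (\<lambda>x. (q \<bullet> x, x)) ` M \<in> U}"
    by (simp only: mem_Collect_eq span_\<phi> simp_thms)
  moreover have "p \<in> {q. (\<lambda>x. (q \<bullet> x, x)) ` M \<in> U}"
    using N(2) homogenization_subspace_Int_hyperplane [OF M(1) ne] by (simp add: U)
  ultimately have "\<forall>\<^sub>F q in nhds p. q \<in> {q. (\<lambda>x. (q \<bullet> x, x)) ` M \<in> U}"
    by (rule eventually_nhds_in_open)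
  then show ?thesis
  proof eventually_elim
    case (elim q)
    show ?case
    proof
      assume ne: "M \<inter> {x. q \<bullet> x = 1} \<noteq> {}"
      have "M \<inter> {x. q \<bullet> x = 1} \<in> affine_subspaces_of_dim d"
        using aff_dim_subspace_Int_hyperplane [OF M(1) ne] M
        by (simp add: affine_subspaces_of_dim_def subspace_imp_affine affine_Int affine_hyperplane)
      then show "M \<inter> {x. q \<bullet> x = 1} \<in> N"
        using elim homogenization_subspace_Int_hyperplane [OF M(1) ne] by (simp add: U)
    qed
  qed
qed

text \<open>Tilting \<open>p\<close> towards \<open>k\<close> makes its value at \<open>k\<close>
  strictly positive, so that a positive multiple of \<open>k\<close> becomes feasible arbitrarily
  close to \<open>L\<close>.\<close>

lemma not_stably_infeasible:
  fixes K L :: "'a::euclidean_space set"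
  assumes K: "cone K" and L: "L = span L \<inter> {x. p \<bullet> x = 1}" "L \<noteq> {}"
    and k: "k \<in> K" "k \<in> span L" "k \<noteq> 0" "p \<bullet> k \<ge> 0"
  shows "\<not> stably_infeasible K L"
proof
  assume "stably_infeasible K L"
  then obtain N where N: "openin (affine_grassmannian_topology (nat (aff_dim L))) N" "L \<in> N"
    "\<And>L'. L' \<in> N \<Longrightarrow> K \<inter> L' = {}"
    by (auto simp: stably_infeasible_def)
  have "aff_dim L = int (dim (span L)) - 1"
    using aff_dim_subspace_Int_hyperplane [of "span L" p] L by simp
  moreover have "aff_dim L \<ge> 0"
    using L(2) by (metis aff_dim_negative_iff linorder_not_less)
  ultimately have "dim (span L) = Suc (nat (aff_dim L))"
    by simp
  then have "\<forall>\<^sub>F q in nhds p. span L \<inter> {x. q \<bullet> x = 1} \<noteq> {} \<longrightarrow> span L \<inter> {x. q \<bullet> x = 1} \<in> N"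
    using N L by (intro eventually_affine_grassmannian_nbhd) auto
  \<comment> \<open>The one-sided limit keeps \<open>t > 0\<close>, which matters when
    \<open>p \<bullet> k = 0\<close>.\<close>
  moreover have "((\<lambda>t::real. p + t *\<^sub>R k) \<longlongrightarrow> p) (at_right 0)"
    by (auto intro!: tendsto_eq_intros)
  ultimately have "\<forall>\<^sub>F t in at_right (0::real). span L \<inter> {x. (p + t *\<^sub>R k) \<bullet> x = 1} \<noteq> {} \<longrightarrow>
      span L \<inter> {x. (p + t *\<^sub>R k) \<bullet> x = 1} \<in> N"
    by (rule eventually_compose_filterlim)
  then have "\<forall>\<^sub>F t in at_right (0::real). t > 0 \<and> (span L \<inter> {x. (p + t *\<^sub>R k) \<bullet> x = 1} \<noteq> {} \<longrightarrow>
      span L \<inter> {x. (p + t *\<^sub>R k) \<bullet> x = 1} \<in> N)"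
    by (intro eventually_conj eventually_at_right_less)
  then obtain t :: real where t: "t > 0"
    "span L \<inter> {x. (p + t *\<^sub>R k) \<bullet> x = 1} \<noteq> {} \<Longrightarrow> span L \<inter> {x. (p + t *\<^sub>R k) \<bullet> x = 1} \<in> N"
    using eventually_happens' [OF trivial_limit_at_right_real] by blast
  \<comment> \<open>Here \<open>s = p \<bullet> k + t * (k \<bullet> k)\<close>; scaling
    \<open>k\<close> by \<open>1 / s\<close> puts it on the tilted hyperplane, which also shows that
    the section is nonempty.\<close>
  define s where "s = (p + t *\<^sub>R k) \<bullet> k"
  have "s > 0"
    using k t by (simp add: s_def inner_add_left add_nonneg_pos)
  then have "(1 / s) *\<^sub>R k \<in> span L \<inter> {x. (p + t *\<^sub>R k) \<bullet> x = 1}"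
    using k(2) by (simp add: span_scale s_def)
  moreover have "(1 / s) *\<^sub>R k \<in> K"
    using K k(1) \<open>s > 0\<close> by (intro mem_cone) auto
  ultimately show False
    using t(2) N(3) by blast
qed

theorem theorem2p10:
  fixes K L :: "'a::euclidean_space set"
  assumes "regular_cone K"
    and "affine L" and "L \<noteq> {}"
    and "0 \<notin> L"
    and "int DIM('a) - aff_dim L \<ge> 2"
  shows "stably_infeasible K L \<and> stably_infeasible (uminus ` K) L \<longleftrightarrow> K \<inter> span L = {0}"
proof
  have K: "closed K" "cone K" "0 \<in> K"
    using assms(1) by (auto simp: regular_cone_def)
  then have K': "closed (uminus ` K)" "cone (uminus ` K)"
    by (auto simp: closed_negations cone_def image_iff)
  show "stably_infeasible K L \<and> stably_infeasible (uminus ` K) L" if "K \<inter> span L = {0}"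
  proof
    show "stably_infeasible K L"
      using K assms that by (intro stably_infeasible_if_span_Int_trivial) auto
    have "uminus ` K \<inter> span L \<subseteq> {0}"
      using that span_neg by fastforce
    then show "stably_infeasible (uminus ` K) L"
      using K' assms by (intro stably_infeasible_if_span_Int_trivial)
  qed
  show "K \<inter> span L = {0}" if stable: "stably_infeasible K L \<and> stably_infeasible (uminus ` K) L"
  proof (rule ccontr)
    assume "K \<inter> span L \<noteq> {0}"
    then obtain k where k: "k \<in> K" "k \<in> span L" "k \<noteq> 0"
      using K(3) span_0 by blast
    obtain p where p: "L = span L \<inter> {x. p \<bullet> x = 1}"
      using affine_eq_span_Int_hyperplane [OF assms(2-4)] .
    show False
    proof (cases "p \<bullet> k \<ge> 0")
      case True
      then show False
        using not_stably_infeasible [OF K(2) p assms(3) k] stable by blast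
    next
      case False
      then show False
        using not_stably_infeasible [OF K'(2) p assms(3), of "- k"] k stable
        by (simp add: span_neg)
    qed
  qed
qed

end
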